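(* Let $s_1,s_2,s_3,s_4\ge 0$ be real numbers and define $\beta(\phi)=\|(s_1e^{\mathrm i\phi},s_2,s_3,s_4)\|_{\mathsf X}$. Then the function $\beta$ is strictly decreasing on the interval $\phi\in[0,\pi]$ if and only if $s_j>0$ for $j=1,2,3,4$.
   Context: On $\mathbb C^4$ define the norm $\|z\|_{\mathsf X}=\max_{\sigma\in\mathbb R}\left(|z_1e^{\mathrm i\sigma}+\bar z_4|+|z_2e^{\mathrm i\sigma}+\bar z_3|\right)$. *)

theory Defs
  imports "HOL-Analysis.Analysis"
begin

lemma vector_4 [simp]:
  "(vector [a, b, c, d] :: 'a::zero ^ 4) $ 1 = a"
  "(vector [a, b, c, d] :: 'a::zero ^ 4) $ 2 = b"
  "(vector [a, b, c, d] :: 'a::zero ^ 4) $ 3 = c"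
  "(vector [a, b, c, d] :: 'a::zero ^ 4) $ 4 = d"
  unfolding vector_def by simp_all

definition X_fun :: "complex ^ 4 \<Rightarrow> real \<Rightarrow> real" where
  "X_fun z \<sigma> = cmod (z $ 1 * exp (\<i> * of_real \<sigma>) + cnj (z $ 4))
              + cmod (z $ 2 * exp (\<i> * of_real \<sigma>) + cnj (z $ 3))"

text \<open>The maximum over the real line is written as a supremum; the lemmas below show that
  it is attained, so that it is a genuine maximum.\<close>

definition X_norm :: "complex ^ 4 \<Rightarrow> real" where
  "X_norm z = (SUP \<sigma>. X_fun z \<sigma>)"

lemma X_fun_attains_max: "\<exists>\<sigma>. \<forall>\<tau>. X_fun z \<tau> \<le> X_fun z \<sigma>"
proof -
  define g where "g = (\<lambda>w. cmod (z $ 1 * w + cnj (z $ 4)) + cmod (z $ 2 * w + cnj (z $ 3)))"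
  have "continuous_on (sphere 0 1) g"
    unfolding g_def by (intro continuous_intros)
  moreover have "compact (sphere (0::complex) 1)" "sphere (0::complex) 1 \<noteq> {}"
    by auto
  ultimately obtain w where w: "w \<in> sphere 0 1" "\<And>v. v \<in> sphere 0 1 \<Longrightarrow> g v \<le> g w"
    using continuous_attains_sup by metis
  from w(1) have "w = exp (\<i> * of_real (Arg w))"
    using Arg_eq[of w] by fastforce
  then have "X_fun z (Arg w) = g w"
    unfolding X_fun_def g_def by simp
  moreover have "X_fun z \<tau> \<le> g w" for \<tau>
    using w(2)[of "exp (\<i> * of_real \<tau>)"] by (simp add: X_fun_def g_def)
  ultimately show ?thesis
    by metis
qed

lemma X_norm_attained: "\<exists>\<sigma>. X_norm z = X_fun z \<sigma> \<and> (\<forall>\<tau>. X_fun z \<tau> \<le> X_norm z)"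
proof -
  obtain \<sigma> where \<sigma>: "\<forall>\<tau>. X_fun z \<tau> \<le> X_fun z \<sigma>"
    using X_fun_attains_max by blast
  have "X_norm z = X_fun z \<sigma>"
    unfolding X_norm_def using \<sigma> by (intro cSup_eq_maximum) auto
  then show ?thesis
    using \<sigma> by auto
qed

end

theory Submission
  imports Defs
begin

text \<open>The maximum defining \<open>\<beta> \<phi>\<close> is that of \<open>r(\<phi> + \<sigma>) + r'(\<sigma>)\<close> with two functions of the cosine of
  their argument. Replacing the arguments at a maximiser by their distances \<open>x, y \<in> [0, \<pi>]\<close> to
  \<open>2\<pi>\<int>\<close> gives \<open>x + y \<ge> \<phi>\<close>. For a smaller angle, \<open>x\<close> and \<open>y\<close> can be shrunk so that their sum becomes
  that angle, which strictly increases the value as soon as both functions strictly decrease on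
  \<open>[0, \<pi>]\<close>. If some \<open>s\<^sub>j\<close> vanishes, one of the functions is constant and hence so is \<open>\<beta>\<close>.\<close>

text \<open>Law of cosines: the third side of a triangle whose sides \<open>p\<close> and
  \<open>q\<close> enclose the angle \<open>pi - t\<close>.\<close>

definition side :: "real \<Rightarrow> real \<Rightarrow> real \<Rightarrow> real" where
  "side p q t = sqrt (p\<^sup>2 + q\<^sup>2 + 2 * p * q * cos t)"

lemma cmod_eq_side: "cmod (of_real p * exp (\<i> * of_real t) + of_real q) = side p q t"
proof -
  have "(p * cos t + q)\<^sup>2 + (p * sin t)\<^sup>2 = p\<^sup>2 * ((cos t)\<^sup>2 + (sin t)\<^sup>2) + q\<^sup>2 + 2 * p * q * cos t"
    by algebra
  then show ?thesis
    by (simp add: cmod_def side_def Re_exp Im_exp)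
qed

lemma side_cong: "cos s = cos t \<Longrightarrow> side p q s = side p q t"
  by (simp add: side_def)

lemma side_const: "p * q = 0 \<Longrightarrow> side p q s = side p q t"
  by (auto simp: side_def)

lemma side_strict_antimono:
  assumes "p > 0" "q > 0" "0 \<le> s" "s < t" "t \<le> pi"
  shows "side p q t < side p q s"
  using assms cos_monotone_0_pi[of s t] by (simp add: side_def)

lemma side_antimono:
  assumes "p > 0" "q > 0" "0 \<le> s" "s \<le> t" "t \<le> pi"
  shows "side p q t \<le> side p q s"
  using assms side_strict_antimono[of p q s t] by (cases "s = t") auto

lemma X_fun_eq_side:
  "X_fun (vector [of_real s1 * exp (\<i> * of_real \<phi>), of_real s2, of_real s3, of_real s4]) \<sigma>
     = side s1 s4 (\<phi> + \<sigma>) + side s2 s3 \<sigma>"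
proof -
  have "of_real s1 * exp (\<i> * of_real \<phi>) * exp (\<i> * of_real \<sigma>)
      = of_real s1 * exp (\<i> * of_real (\<phi> + \<sigma>))"
    by (simp add: exp_add algebra_simps)
  then show ?thesis
    unfolding X_fun_def vector_4 complex_cnj_complex_of_real by (simp only: cmod_eq_side)
qed

text \<open>Triangle inequality for the distance \<open>arccos (cos t)\<close> from \<open>t\<close>
  to the multiples of \<open>2 * pi\<close>; since \<open>a - b\<close> is at most
  \<open>pi\<close>, it does not exceed its own such distance.\<close>

lemma arccos_cos_add_ge:
  assumes "a - b \<le> pi"
  shows "a - b \<le> arccos (cos a) + arccos (cos b)"
proof (rule ccontr)
  assume "\<not> ?thesis"
  moreover have "0 \<le> arccos (cos a)" "0 \<le> arccos (cos b)"
    by (simp_all add: arccos_lbound)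
  ultimately have "cos (a - b) < cos (arccos (cos a) + arccos (cos b))"
    using assms by (intro cos_monotone_0_pi) auto
  \<comment> \<open>Both arccosines lie in \<open>[0, pi]\<close>, so their sines are the absolute
    values of \<open>sin a\<close> and \<open>sin b\<close>.\<close>
  also have "\<dots> = cos a * cos b - \<bar>sin a * sin b\<bar>"
    by (simp add: cos_add sin_arccos_abs abs_mult flip: sin_squared_eq)
  also have "\<dots> \<le> cos (a - b)"
    by (simp add: cos_diff)
  finally show False
    by simp
qed

lemma side_sum_increase:
  assumes "s1 > 0" "s2 > 0" "s3 > 0" "s4 > 0" "0 \<le> \<phi>" "\<phi> < \<psi>" "\<psi> \<le> pi"
  shows "\<exists>\<tau>. side s1 s4 (\<psi> + \<sigma>) + side s2 s3 \<sigma> < side s1 s4 (\<phi> + \<tau>) + side s2 s3 \<tau>"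
proof -
  define x where "x = arccos (cos (\<psi> + \<sigma>))"
  define y where "y = arccos (cos \<sigma>)"
  have range: "0 \<le> x" "x \<le> pi" "0 \<le> y" "y \<le> pi"
    by (simp_all add: x_def y_def arccos_lbound arccos_ubound)
  have sum: "\<psi> \<le> x + y"
    using arccos_cos_add_ge[of "\<psi> + \<sigma>" \<sigma>] assms by (simp add: x_def y_def)
  have "side s1 s4 (\<psi> + \<sigma>) = side s1 s4 x" "side s2 s3 \<sigma> = side s2 s3 y"
    by (rule side_cong; simp add: x_def y_def)+
  \<comment> \<open>The new arguments add up to \<phi> and exceed neither \<open>x\<close> nor
    \<open>y\<close>. If \<phi> < \<open>x\<close>, the first one drops strictly; otherwise it stays
    \<open>x\<close>, and \<phi> - \<open>x\<close> < \<open>y\<close> because \<phi> < \<psi> \<le>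
    \<open>x + y\<close>.\<close>
  moreover have "side s1 s4 x + side s2 s3 y
      < side s1 s4 (min x \<phi>) + side s2 s3 (\<phi> - min x \<phi>)"
  proof (cases "\<phi> < x")
    case True
    then show ?thesis
      using assms range side_strict_antimono[of s1 s4 \<phi> x] side_antimono[of s2 s3 0 y]
      by (simp add: min_def)
  next
    case False
    then show ?thesis
      using assms range sum side_strict_antimono[of s2 s3 "\<phi> - x" y] by (simp add: min_def)
  qed
  \<comment> \<open>The shift \<tau> = \<open>min x\<close> \<phi> - \<phi> produces the first
    argument exactly and the second up to sign, which the even cosine ignores.\<close>
  moreover have "side s2 s3 (\<phi> - min x \<phi>) = side s2 s3 (min x \<phi> - \<phi>)"
    by (rule side_cong) (metis cos_minus minus_diff_eq)
  ultimately show ?thesis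
    by (intro exI[of _ "min x \<phi> - \<phi>"]) simp
qed

theorem proposition3p8:
  fixes s1 s2 s3 s4 :: real and \<beta> :: "real \<Rightarrow> real"
  assumes "s1 \<ge> 0" "s2 \<ge> 0" "s3 \<ge> 0" "s4 \<ge> 0"
    and "\<And>\<phi>. \<beta> \<phi> = X_norm (vector [of_real s1 * exp (\<i> * of_real \<phi>), of_real s2, of_real s3, of_real s4])"
  shows "strict_antimono_on {0..pi} \<beta> \<longleftrightarrow> s1 > 0 \<and> s2 > 0 \<and> s3 > 0 \<and> s4 > 0"
proof
  have attained: "\<exists>\<sigma>. \<beta> \<phi> = side s1 s4 (\<phi> + \<sigma>) + side s2 s3 \<sigma>" for \<phi>
    unfolding assms(5) X_fun_eq_side[symmetric] using X_norm_attained by blast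
  have upper: "side s1 s4 (\<phi> + \<sigma>) + side s2 s3 \<sigma> \<le> \<beta> \<phi>" for \<phi> \<sigma>
    unfolding assms(5) X_fun_eq_side[symmetric] using X_norm_attained by blast
  show "s1 > 0 \<and> s2 > 0 \<and> s3 > 0 \<and> s4 > 0" if "strict_antimono_on {0..pi} \<beta>"
  proof (rule ccontr)
    assume "\<not> ?thesis"
    then have zero: "s1 * s4 = 0 \<or> s2 * s3 = 0"
      using assms(1-4) by force
    obtain \<sigma> where \<sigma>: "\<beta> 0 = side s1 s4 \<sigma> + side s2 s3 \<sigma>"
      using attained[of 0] by auto
    \<comment> \<open>One summand is constant, so \<sigma> only has to preserve the argument of the
      other: keep it, or shift it by \<open>- pi\<close>.\<close>
    have "\<beta> 0 \<le> \<beta> pi"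
    proof (cases "s1 * s4 = 0")
      case True
      then show ?thesis
        using \<sigma> upper[of pi \<sigma>] side_const[of s1 s4 \<sigma> "pi + \<sigma>"] by simp
    next
      case False
      then show ?thesis
        using \<sigma> zero upper[of pi "\<sigma> - pi"] side_const[of s2 s3 \<sigma> "\<sigma> - pi"] by simp
    qed
    moreover have "\<beta> pi < \<beta> 0"
      using that by (auto simp: monotone_on_def)
    ultimately show False
      by simp
  qed
  show "strict_antimono_on {0..pi} \<beta>" if pos: "s1 > 0 \<and> s2 > 0 \<and> s3 > 0 \<and> s4 > 0"
  proof (rule monotone_onI)
    fix \<phi> \<psi> :: real
    assume "\<phi> \<in> {0..pi}" "\<psi> \<in> {0..pi}" "\<phi> < \<psi>"
    then show "\<beta> \<psi> < \<beta> \<phi>"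
      using pos attained[of \<psi>] side_sum_increase[of s1 s2 s3 s4 \<phi> \<psi>] upper[of \<phi>]
      by (metis atLeastAtMost_iff less_le_trans)
  qed
qed

end
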